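(* There exists a constant $c \ge 25$ such that for every integer $k$ with $8 \le k \le c$ and $k \ne 9$, and all integers $p \ge k+2$ and $q \ge k+1$, $$r_k(p,q) \ge (p-1)\cdot\bigl(r_k(p-1,q)-1\bigr)+1.$$
   Context: For integers $k,p,q$, the Ramsey number $r_k(p,q)$ is the smallest integer $N$ such that for every coloring of all $k$-element subsets of $\{1,\dots,N\}$ with the colors red and blue, there exist either $p$ elements of $\{1,\dots,N\}$ all of whose $k$-element subsets are red, or $q$ elements of $\{1,\dots,N\}$ all of whose $k$-element subsets are blue. *)

theory Defs
  imports Complex_Main "HOL-Library.Ramsey"
begin

text \<open>Colour 0 is red and goes with \<open>p\<close>; colour 1 is blue and goes with \<open>q\<close>.\<close>

definition ramsey_number :: "nat \<Rightarrow> nat \<Rightarrow> nat \<Rightarrow> nat" where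
  "ramsey_number k p q = (LEAST N. partn_lst {1..N} [p, q] k)"

text \<open>The minimum is attained, so \<open>LEAST\<close> never ranges over an empty set.\<close>

lemma partn_lst_ramsey_number: "partn_lst {1..ramsey_number k p q} [p, q] k"
proof -
  obtain N :: nat where N: "partn_lst {..<N} [p, q] k"
    using ramsey_full by blast
  have "partn_lst {1..N} [p, q] k"
    unfolding partn_lst_def
  proof
    fix f assume f: "f \<in> nsets {1..N} k \<rightarrow> {..<length [p, q]}"
    have Suc_in: "Suc ` X \<in> nsets {1..N} m" if "X \<in> nsets {..<N} m" for X m
      using that by (auto simp: nsets_def card_image)
    have "(\<lambda>X. f (Suc ` X)) \<in> nsets {..<N} k \<rightarrow> {..<length [p, q]}"
      using f Suc_in by blast
    then obtain i H where i: "i < length [p, q]" and H: "H \<in> nsets {..<N} ([p, q] ! i)"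
      and mono: "(\<lambda>X. f (Suc ` X)) ` nsets H k \<subseteq> {i}"
      using N unfolding partn_lst_def monochromatic_def by blast
    have "f Y = i" if Y: "Y \<in> nsets (Suc ` H) k" for Y
    proof -
      obtain X where "X \<subseteq> H" "Y = Suc ` X"
        using Y unfolding nsets_def by (auto simp: subset_image_iff)
      moreover from this have "X \<in> nsets H k"
        using Y by (auto simp: nsets_def card_image finite_image_iff)
      ultimately show ?thesis
        using mono by auto
    qed
    then show "\<exists>i<length [p, q]. monochromatic {1..N} ([p, q] ! i) k f i"
      using i Suc_in[OF H] unfolding monochromatic_def by blast
  qed
  then show ?thesis
    unfolding ramsey_number_def by (rule LeastI)
qed

end

theory Submission
  imports Defs "HOL-Library.Multiset"
begin

text \<open>The proof extends a colouring of a set of \<open>N\<close> points, \<open>N = r\<^sub>k(p - 1, q) - 1\<close>, with neither a red \<open>(p - 1)\<close>-set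
nor a blue \<open>q\<close>-set, to \<open>p - 1\<close> disjoint copies of this set, called groups.  A \<open>k\<close>-set inside one group keeps its
colour.  The colour of any other \<open>k\<close>-set depends only on its shape, the partition of \<open>k\<close> into the
numbers of its points in the groups.  The result has neither a red \<open>p\<close>-set nor a blue \<open>q\<close>-set provided
that the colour of shapes has two properties (\<open>splitting_colour\<close>): from a set of \<open>k + 1\<close> points in
several groups one can remove a point so that a red set remains, and from a set of \<open>k + 2\<close> points, with a few
exceptions, one can remove two points so that a blue set remains (\<open>product_colouring\<close>).  Then
\<open>(p - 1) \<cdot> N\<close> points are too few, and \<open>r\<^sub>k(p, q)\<close> is larger (\<open>ramsey_number_product_bound\<close>).

This leaves a problem about the partitions of \<open>k\<close>.  Removing a point changes the number of odd parts by one, so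
colouring a partition according to its number of odd parts modulo 4 already works for most partitions.  The
predicate \<open>blue\<close> refines this rule by corrections for partitions with one even part and for a few families of
partitions of special form.  For each \<open>k\<close> in question, the two properties concern finitely many
partitions, and \<open>all_partitions\<close> runs through them; this computation is carried out by rewriting.\<close>

section \<open>Partitions\<close>

text \<open>Integer partitions are represented by the weakly decreasing list of their (positive) parts.\<close>

definition is_partition :: "nat list \<Rightarrow> bool" where
  "is_partition l \<longleftrightarrow> sorted_wrt (\<ge>) l \<and> 0 \<notin> set l"

text \<open>The partitions that arise from a partition by lowering one part by 1, where a part 1 disappears.
Among equal parts only the last one is lowered, so that the list stays decreasing.\<close>

fun children :: "nat list \<Rightarrow> nat list list" where
  "children [] = []"
| "children (x # xs) =
    (if xs = [] \<or> hd xs < x then [if x = 1 then xs else (x - 1) # xs] else [])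
     @ map ((#) x) (children xs)"

lemma childrenE:
  assumes "c \<in> set (children l)"
  obtains xs x ys where "l = xs @ x # ys" "ys = [] \<or> hd ys < x"
    "c = xs @ (if x = 1 then ys else (x - 1) # ys)"
proof -
  have "\<exists>xs x ys. l = xs @ x # ys \<and> (ys = [] \<or> hd ys < x) \<and> c = xs @ (if x = 1 then ys else (x - 1) # ys)"
    using assms
  proof (induction l arbitrary: c)
    case (Cons x l)
    from Cons.prems consider "l = [] \<or> hd l < x" "c = (if x = 1 then l else (x - 1) # l)"
      | d where "d \<in> set (children l)" "c = x # d"
      by (auto split: if_splits)
    then show ?case
    proof cases
      case 1
      then show ?thesis by (intro exI[of _ "[]"]) auto
    next
      case 2
      then obtain xs y ys where "l = xs @ y # ys" "ys = [] \<or> hd ys < y"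
        "d = xs @ (if y = 1 then ys else (y - 1) # ys)"
        using Cons.IH by blast
      with 2 show ?thesis by (intro exI[of _ "x # xs"]) auto
    qed
  qed auto
  with that show thesis by blast
qed

text \<open>The test \<open>P\<close> for all partitions of \<open>i + r\<close> into at least two parts, none of them smaller than \<open>i\<close>,
each extended at its end by the parts \<open>acc\<close> chosen before.  The recursion chooses the parts in increasing
order: after the two-part partition \<open>(r, i)\<close> it treats the other partitions with least part \<open>i\<close>, and then those
without a part \<open>i\<close>.\<close>

function all_partitions :: "(nat list \<Rightarrow> bool) \<Rightarrow> nat \<Rightarrow> nat \<Rightarrow> nat list \<Rightarrow> bool" where
  "all_partitions P i r acc \<longleftrightarrow>
    (if 0 < i \<and> i \<le> r
     then P (r # i # acc) \<and> all_partitions P i (r - i) (i # acc) \<and> all_partitions P (Suc i) (r - 1) acc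
     else True)"
  by auto
termination by (relation "measure (\<lambda>(P, i, r, acc). r)") auto

declare all_partitions.simps [simp del]

lemma all_partitionsD:
  assumes "all_partitions P i r acc" "0 < i" "is_partition l" "2 \<le> length l"
    "sum_list l = i + r" "\<forall>x\<in>set l. i \<le> x"
  shows "P (l @ acc)"
  using assms
proof (induction P i r acc arbitrary: l rule: all_partitions.induct)
  \<comment> \<open>The least part \<open>y\<close> of \<open>l\<close> is its last one.\<close>
  case (1 P i r acc)
  obtain xs y where l: "l = xs @ [y]" "xs \<noteq> []"
    using \<open>2 \<le> length l\<close> by (cases l rule: rev_cases) (auto simp: Suc_le_eq)
  have sorted: "sorted_wrt (\<ge>) xs" "0 \<notin> set xs" "\<forall>x\<in>set xs. y \<le> x"
    using "1.prems"(3) by (auto simp: is_partition_def sorted_wrt_append l)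
  have y: "i \<le> y" using "1.prems"(6) l by auto
  have "y \<le> sum_list xs"
    using sorted(3) l(2) by (cases xs) auto
  with "1.prems"(5) y l have "i \<le> r" by auto
  with "1.prems"(1,2) have P: "P (r # i # acc)" "all_partitions P i (r - i) (i # acc)"
    "all_partitions P (Suc i) (r - 1) acc"
    by (simp_all add: all_partitions.simps[of P i r acc])
  show ?case
  proof (cases "y = i")
    case True
    then have sum: "sum_list xs = r" using "1.prems"(5) l by simp
    show ?thesis
    proof (cases "length xs = 1")
      case True
      then have "xs = [r]" using sum by (auto simp: length_Suc_conv)
      then show ?thesis using P(1) \<open>y = i\<close> l by simp
    next
      case False
      then have "2 \<le> length xs" using l(2) by (cases xs) (auto simp: Suc_le_eq)
      then have "P (xs @ i # acc)"
        using "1.IH"(1)[of xs] P(2) \<open>0 < i\<close> \<open>i \<le> r\<close> sorted sum \<open>y = i\<close>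
        by (auto simp: is_partition_def)
      then show ?thesis using \<open>y = i\<close> l by simp
    qed
  next
    case False
    then have "\<forall>x\<in>set l. Suc i \<le> x" using y sorted(3) l by fastforce
    then show ?thesis
      using "1.IH"(2)[of l] P(3) "1.prems" \<open>i \<le> r\<close> by auto
  qed
qed

section \<open>The shape of a set of grouped points\<close>

text \<open>The shape of a set \<open>T\<close>, whose points are sorted into groups by \<open>g\<close>: the partition of the cardinality of \<open>T\<close>
formed by the sizes of the nonempty groups.\<close>

definition shape :: "('a \<Rightarrow> 'b) \<Rightarrow> 'a set \<Rightarrow> nat list" where
  "shape g T = rev (sorted_list_of_multiset (image_mset (\<lambda>i. card {x \<in> T. g x = i}) (mset_set (g ` T))))"

lemma mset_shape: "mset (shape g T) = image_mset (\<lambda>i. card {x \<in> T. g x = i}) (mset_set (g ` T))"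
  by (simp add: shape_def)

lemma shape_eqI:
  assumes "sorted_wrt (\<ge>) l"
    and "mset l = image_mset (\<lambda>i. card {x \<in> T. g x = i}) (mset_set (g ` T))"
  shows "shape g T = l"
proof -
  have "sort l = rev l"
    using assms(1) by (intro properties_for_sort) (simp_all add: sorted_wrt_rev)
  then show ?thesis
    unfolding shape_def assms(2)[symmetric] sorted_list_of_multiset_mset by simp
qed

lemma is_partition_shape:
  assumes "finite T"
  shows "is_partition (shape g T)"
proof -
  have "sorted_wrt (\<ge>) (shape g T)"
    by (simp add: shape_def sorted_wrt_rev)
  moreover have "0 \<notin> set (shape g T)"
    using assms by (auto simp: mset_shape simp flip: set_mset_mset)
  ultimately show ?thesis by (simp add: is_partition_def)
qed

lemma length_shape: "length (shape g T) = card (g ` T)"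
  by (simp add: mset_shape flip: size_mset)

lemma in_set_shape:
  assumes "finite T"
  shows "n \<in> set (shape g T) \<longleftrightarrow> (\<exists>t\<in>T. n = card {x \<in> T. g x = g t})"
  using assms by (auto simp: mset_shape simp flip: set_mset_mset)

lemma sum_list_shape:
  assumes "finite T"
  shows "sum_list (shape g T) = card T"
proof -
  have "sum_list (shape g T) = sum_mset (mset (shape g T))" by (simp add: sum_mset_sum_list)
  also have "\<dots> = (\<Sum>i\<in>g ` T. card {x \<in> T. g x = i})"
    by (simp add: mset_shape sum_unfold_sum_mset)
  also have "\<dots> = card T"
    using assms sum.image_gen[of T "\<lambda>_. 1::nat" g] by simp
  finally show ?thesis .
qed

text \<open>Lowering a part of the shape is the same as removing a point from a group of that size.\<close>

lemma shape_remove: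
  assumes T: "finite T" and c: "c \<in> set (children (shape g T))"
  obtains t where "t \<in> T" "shape g (T - {t}) = c"
proof -
  obtain xs x ys where s: "shape g T = xs @ x # ys" "ys = [] \<or> hd ys < x"
    "c = xs @ (if x = 1 then ys else (x - 1) # ys)"
    using c by (rule childrenE)
  have part: "is_partition (xs @ x # ys)"
    using is_partition_shape[OF T, of g] s by simp
  then have "0 < x" by (auto simp: is_partition_def)
  have "x \<in> set (shape g T)" by (simp add: s)
  then obtain t where t: "t \<in> T" "x = card {y \<in> T. g y = g t}"
    using T by (auto simp: in_set_shape)
  let ?J = "g ` T - {g t}"
  let ?M = "image_mset (\<lambda>i. card {x \<in> T. g x = i}) (mset_set ?J)"
  have gT: "g ` T = insert (g t) ?J" using t by auto
  have "mset (shape g T) = add_mset x ?M"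
    using T t(2) unfolding mset_shape by (subst gT, subst mset_set.insert) auto
  then have M: "?M = mset xs + mset ys" by (simp add: s)
  have fibre: "{y \<in> T - {t}. g y = g t} = {y \<in> T. g y = g t} - {t}" by auto
  have card: "card {y \<in> T - {t}. g y = g t} = x - 1"
    using t T unfolding fibre by simp
  have other: "image_mset (\<lambda>i. card {y \<in> T - {t}. g y = i}) (mset_set ?J) = ?M"
  proof (rule image_mset_cong)
    fix i assume "i \<in># mset_set ?J"
    then have "i \<noteq> g t" using T by simp
    then have "{y \<in> T - {t}. g y = i} = {y \<in> T. g y = i}" by auto
    then show "card {y \<in> T - {t}. g y = i} = card {y \<in> T. g y = i}" by simp
  qed
  have "shape g (T - {t}) = c"
  proof (rule shape_eqI)
    have "sorted_wrt (\<ge>) xs" "sorted_wrt (\<ge>) ys" "\<forall>u\<in>set xs. x \<le> u \<and> (\<forall>v\<in>set ys. v \<le> u)"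
      using part by (auto simp: is_partition_def sorted_wrt_append)
    moreover have "\<forall>v\<in>set ys. v \<le> x - 1"
    proof (cases ys)
      case (Cons z zs)
      then have "\<forall>v\<in>set ys. v \<le> z" using \<open>sorted_wrt (\<ge>) ys\<close> by auto
      moreover have "z \<le> x - 1" using s(2) Cons by auto
      ultimately show ?thesis by (auto intro: le_trans)
    qed auto
    ultimately show "sorted_wrt (\<ge>) c"
      unfolding s(3) by (auto simp: sorted_wrt_append intro: le_trans)
    show "mset c = image_mset (\<lambda>i. card {y \<in> T - {t}. g y = i}) (mset_set (g ` (T - {t})))"
    proof (cases "x = 1")
      case True
      then have "{y \<in> T. g y = g t} = {t}"
        using t by (metis (mono_tags, lifting) card_1_singletonE mem_Collect_eq singletonD)
      then have "g ` (T - {t}) = ?J" by fastforce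
      then show ?thesis using other M s True by simp
    next
      case False
      then have "card {y \<in> T - {t}. g y = g t} \<noteq> 0" using card \<open>0 < x\<close> by simp
      then have "{y \<in> T - {t}. g y = g t} \<noteq> {}" by (metis card.empty)
      then obtain y where "y \<in> T - {t}" "g y = g t" by blast
      then have "g t \<in> g ` (T - {t})" by (metis image_eqI)
      then have "g ` (T - {t}) = insert (g t) ?J" by auto
      then have "mset_set (g ` (T - {t})) = add_mset (g t) (mset_set ?J)"
        using T by (metis DiffE finite_Diff finite_imageI insertI1 mset_set.insert)
      then show ?thesis using other M s(3) False card by simp
    qed
  qed
  with t(1) show thesis by (rule that)
qed


section \<open>The product colouring\<close>

text \<open>A set \<open>B\<close> of blue partitions of \<open>k\<close> that suits the product colouring below.  Every partition of \<open>k + 1\<close> into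
several parts can be lowered to a red one, and every partition of \<open>k + 2\<close> into several parts, except
\<open>(1, \<dots>, 1)\<close> and \<open>(k + 1, 1)\<close>, can be lowered twice to a blue one.  Partitions with a single part have no
colour: sets inside one group are coloured by other means.\<close>

definition splitting_colour :: "nat \<Rightarrow> (nat list \<Rightarrow> bool) \<Rightarrow> bool" where
  "splitting_colour k B \<longleftrightarrow>
    (\<forall>l. is_partition l \<and> 2 \<le> length l \<longrightarrow>
      (sum_list l = k + 1 \<longrightarrow> (\<exists>c\<in>set (children l). 2 \<le> length c \<and> \<not> B c)) \<and>
      (sum_list l = k + 2 \<and> hd l \<noteq> 1 \<and> hd l \<le> k \<longrightarrow>
        (\<exists>c\<in>set (children l). \<exists>d\<in>set (children c). 2 \<le> length d \<and> B d)))"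

lemma monochromaticI:
  assumes "H \<subseteq> U" "finite H" "n \<le> card H" "\<And>X. X \<subseteq> H \<Longrightarrow> finite X \<Longrightarrow> card X = k \<Longrightarrow> f X = i"
  shows "monochromatic U n k f i"
proof -
  obtain H' where "H' \<subseteq> H" "card H' = n" "finite H'"
    using assms(2,3) by (metis obtain_subset_with_card_n finite_subset)
  with assms show ?thesis
    unfolding monochromatic_def nsets_def by (intro bexI[of _ H']) auto
qed

text \<open>The points of \<open>V\<close> lie in fewer than \<open>p\<close> groups, given by \<open>g\<close>, and \<open>h\<close> identifies each group with a subset
of \<open>W\<close>.  The set \<open>W\<close> has a good colouring \<open>\<chi>\<close> for \<open>(p - 1, q)\<close>, which is copied to each group; all other
\<open>k\<close>-sets are coloured by their shape.

A blue \<open>q\<close>-set that meets two groups contains such a set with \<open>k + 1\<close> points, hence a red \<open>k\<close>-set.  A red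
\<open>p\<close>-set has two points in one group, because there are fewer than \<open>p\<close> groups, and for each group
it has two points outside this group, because no group contains \<open>p - 1\<close> of its points.  Hence it has a subset
with \<open>k + 2\<close> points whose shape has largest part at least 2 and at most \<open>k\<close>, and thus a blue \<open>k\<close>-set.\<close>

lemma product_colouring:
  fixes g :: "'a \<Rightarrow> 'b" and h :: "'a \<Rightarrow> 'c"
  assumes B: "splitting_colour k B" and k: "2 \<le> k" "k + 2 \<le> p" "k + 1 \<le> q"
    and inj: "inj_on (\<lambda>x. (g x, h x)) V" and V: "finite V" "card (g ` V) < p" "h ` V \<subseteq> W"
    and W: "\<not> partn_lst W [p - 1, q] k"
  shows "\<not> partn_lst V [p, q] k"
proof
  assume contr: "partn_lst V [p, q] k"
  obtain \<chi> where \<chi>: "\<chi> \<in> nsets W k \<rightarrow> {..<length [p - 1, q]}"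
    and no_mono: "\<And>i. i < length [p - 1, q] \<Longrightarrow> \<not> monochromatic W ([p - 1, q] ! i) k \<chi> i"
    using W unfolding partn_lst_def by blast
  define f where "f X = (if card (g ` X) = 1 then \<chi> (h ` X) else if B (shape g X) then 1 else 0)" for X
  have inj_h: "inj_on h X" if "X \<subseteq> V" "g ` X \<subseteq> {i}" for X i
  proof (rule inj_onI)
    fix x y assume xy: "x \<in> X" "y \<in> X" "h x = h y"
    then have "g x = g y" using that(2) by blast
    then show "x = y" using inj_onD[OF inj, of x y] xy that(1) by auto
  qed
  \<comment> \<open>Inside one group, monochromatic sets project to monochromatic sets of \<open>\<chi>\<close>.\<close>
  have group: False
    if H: "H \<subseteq> V" "g ` H \<subseteq> {i}" "j < 2" "[p - 1, q] ! j \<le> card H"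
      and f: "\<And>X. X \<subseteq> H \<Longrightarrow> card X = k \<Longrightarrow> f X = j" for H i j
  proof -
    have fin: "finite H" using H(1) V(1) finite_subset by blast
    have "monochromatic W ([p - 1, q] ! j) k \<chi> j"
    proof (rule monochromaticI[of "h ` H"])
      show "h ` H \<subseteq> W" using H(1) V(3) by blast
      show "finite (h ` H)" using fin by simp
      show "[p - 1, q] ! j \<le> card (h ` H)"
        using H(4) card_image[OF inj_h[OF H(1,2)]] by simp
      fix Y assume Y: "Y \<subseteq> h ` H" "card Y = k"
      then obtain X where X: "X \<subseteq> H" "Y = h ` X" by (auto simp: subset_image_iff)
      then have "inj_on h X" using inj_h[OF H(1,2)] inj_on_subset by blast
      then have cX: "card X = k" using X Y card_image by fastforce
      then have "X \<noteq> {}" using k by auto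
      then have "g ` X = {i}" using X H(2) by blast
      then show "\<chi> Y = j" using f[OF X(1) cX] X by (simp add: f_def)
    qed
    with no_mono[of j] H(3) show False by simp
  qed
  have f_range: "f \<in> nsets V k \<rightarrow> {..<length [p, q]}"
  proof
    fix X assume X: "X \<in> nsets V k"
    show "f X \<in> {..<length [p, q]}"
    proof (cases "card (g ` X) = 1")
      case True
      then obtain i where i: "g ` X = {i}" by (auto simp: card_1_singleton_iff)
      have "inj_on h X" using X i by (intro inj_h) (auto simp: nsets_def)
      then have "card (h ` X) = k" using X by (simp add: nsets_def card_image)
      then have "h ` X \<in> nsets W k" using X V(3) by (auto simp: nsets_def)
      then show ?thesis using \<chi> True by (auto simp: f_def)
    qed (auto simp: f_def)
  qed
  then obtain j where "j < length [p, q]" "monochromatic V ([p, q] ! j) k f j"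
    using contr unfolding partn_lst_def by blast
  then obtain H where j: "j < 2" and H: "H \<subseteq> V" "finite H" "card H = [p, q] ! j"
    and mono: "\<And>X. X \<subseteq> H \<Longrightarrow> card X = k \<Longrightarrow> f X = j"
    unfolding monochromatic_def nsets_def by (auto simp: image_subset_iff intro: finite_subset)
  from j consider "j = 1" | "j = 0" by linarith
  then show False
  proof cases
    \<comment> \<open>a blue set of size \<open>q\<close>\<close>
    case 1
    show False
    proof (cases "\<exists>i. g ` H \<subseteq> {i}")
      case True
      then show False using group[of H _ 1] H mono 1 by auto
    next
      case False
      have "H \<noteq> {}" using False by auto
      then obtain x where x: "x \<in> H" by blast
      with False obtain y where y: "y \<in> H" "g y \<noteq> g x" by blast
      have "card {x, y} \<le> k + 1" "k + 1 \<le> card H" using y k H 1 card_insert_le_m1[of 2 "{y}" x] by auto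
      then obtain T where T: "{x, y} \<subseteq> T" "T \<subseteq> H" "card T = k + 1"
        using exists_subset_between[of "{x, y}" "k + 1" H] H x y by auto
      have finT: "finite T" using T H finite_subset by blast
      have "card {g x, g y} \<le> card (g ` T)" using T finT by (intro card_mono) auto
      then have "2 \<le> length (shape g T)" using y by (simp add: length_shape)
      then obtain c where c: "c \<in> set (children (shape g T))" "2 \<le> length c" "\<not> B c"
        using B is_partition_shape[OF finT, of g] sum_list_shape[OF finT, of g] T
        unfolding splitting_colour_def by metis
      obtain t where t: "t \<in> T" "shape g (T - {t}) = c"
        using shape_remove[OF finT c(1)] .
      have "card (T - {t}) = k" using t T finT by simp
      moreover have "T - {t} \<subseteq> H" using T by blast
      ultimately have "f (T - {t}) = 1" using mono 1 by blast
      moreover have "card (g ` (T - {t})) \<noteq> 1" using c(2) t(2) length_shape[of g "T - {t}"] by simp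
      ultimately show False using c t by (simp add: f_def)
    qed
  next
    \<comment> \<open>a red set of size \<open>p\<close>\<close>
    case 2
    show False
    proof (cases "\<exists>i. card {x \<in> H. g x \<noteq> i} \<le> 1")
      case True
      then obtain i where i: "card {x \<in> H. g x \<noteq> i} \<le> 1" ..
      have "card H = card {x \<in> H. g x = i} + card {x \<in> H. g x \<noteq> i}"
        using H(2) by (subst card_Un_disjoint[symmetric]) (auto intro: arg_cong[where f = card])
      then have "p - 1 \<le> card {x \<in> H. g x = i}" using i H 2 by simp
      then show False
        using group[of "{x \<in> H. g x = i}" i 0] H mono 2 by auto
    next
      case False
      then have out: "2 \<le> card {x \<in> H. g x \<noteq> i}" for i
      proof -
        have "\<not> card {x \<in> H. g x \<noteq> i} \<le> 1" using False by blast
        then show ?thesis by linarith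
      qed
      have "card (g ` H) < card H"
        using H V 2 by (metis (no_types, lifting) card_mono finite_imageI image_mono le_less_trans nth_Cons_0)
      then have "\<not> inj_on g H" by (metis card_image less_irrefl)
      then obtain x y where xy: "x \<in> H" "y \<in> H" "x \<noteq> y" "g x = g y" by (auto simp: inj_on_def)
      obtain Z where Z: "Z \<subseteq> {z \<in> H. g z \<noteq> g x}" "card Z = 2"
        using obtain_subset_with_card_n[OF out] by metis
      have finZ: "finite Z" using Z(2) by (simp add: card_ge_0_finite)
      have disj: "{x, y} \<inter> Z = {}" using Z xy by auto
      have "card ({x, y} \<union> Z) = 4" using disj Z xy finZ by (subst card_Un_disjoint) auto
      then obtain T where T: "{x, y} \<union> Z \<subseteq> T" "T \<subseteq> H" "card T = k + 2"
        using exists_subset_between[of "{x, y} \<union> Z" "k + 2" H] H xy Z k 2 by auto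
      have finT: "finite T" using T H finite_subset by blast
      \<comment> \<open>No part exceeds \<open>k\<close>: outside each group, \<open>T\<close> has the two points of \<open>Z\<close> or the points \<open>x\<close>, \<open>y\<close>.\<close>
      have small: "card {u \<in> T. g u = i} \<le> k" for i
      proof -
        have "2 \<le> card {u \<in> T. g u \<noteq> i}"
        proof (cases "i = g x")
          case True
          then have "Z \<subseteq> {u \<in> T. g u \<noteq> i}" using Z T by auto
          then show ?thesis using Z(2) finT card_mono[of "{u \<in> T. g u \<noteq> i}" Z] by simp
        next
          case False
          then have "{x, y} \<subseteq> {u \<in> T. g u \<noteq> i}" using xy T by auto
          then show ?thesis using xy finT card_mono[of "{u \<in> T. g u \<noteq> i}" "{x, y}"] by simp
        qed
        moreover have "card T = card {u \<in> T. g u = i} + card {u \<in> T. g u \<noteq> i}"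
          using finT by (subst card_Un_disjoint[symmetric]) (auto intro: arg_cong[where f = card])
        ultimately show ?thesis using T(3) by simp
      qed
      have part: "is_partition (shape g T)" and sum: "sum_list (shape g T) = k + 2"
        using is_partition_shape[OF finT] sum_list_shape[OF finT] T by metis+
      have le: "u \<le> k" if "u \<in> set (shape g T)" for u
        using that small finT by (auto simp: in_set_shape)
      have ne: "shape g T \<noteq> []" using sum by auto
      have len: "2 \<le> length (shape g T)"
      proof (rule ccontr)
        assume "\<not> ?thesis"
        then obtain u where "shape g T = [u]" using ne by (cases "shape g T") (auto simp: Suc_le_eq)
        then show False using le[of u] sum by simp
      qed
      have hd: "hd (shape g T) \<noteq> 1"
      proof
        assume hd: "hd (shape g T) = 1"
        have "card {u \<in> T. g u = g x} \<in> set (shape g T)"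
          using T finT by (auto simp: in_set_shape)
        then have "card {u \<in> T. g u = g x} \<le> hd (shape g T)"
          using part by (cases "shape g T") (auto simp: is_partition_def)
        moreover have "card {x, y} \<le> card {u \<in> T. g u = g x}"
          using finT T xy by (intro card_mono) auto
        ultimately show False using hd xy by simp
      qed
      have "hd (shape g T) \<le> k" using le ne by simp
      then obtain c d where c: "c \<in> set (children (shape g T))" and d: "d \<in> set (children c)"
        "2 \<le> length d" "B d"
        using B part sum len hd unfolding splitting_colour_def by metis
      obtain s where s: "s \<in> T" "shape g (T - {s}) = c"
        using shape_remove[OF finT c] .
      obtain t where t: "t \<in> T - {s}" "shape g (T - {s} - {t}) = d"
        using shape_remove[of "T - {s}" d g] finT s d by auto
      have "card (T - {s} - {t}) = k" using s t T finT by simp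
      moreover have "T - {s} - {t} \<subseteq> H" using T by blast
      ultimately have "f (T - {s} - {t}) = 0" using mono 2 by blast
      moreover have "card (g ` (T - {s} - {t})) \<noteq> 1"
        using d t(2) length_shape[of g "T - {s} - {t}"] by simp
      ultimately show False using d t by (simp add: f_def)
    qed
  qed
qed

lemma ramsey_number_product_bound:
  assumes "splitting_colour k B" "2 \<le> k" "k + 2 \<le> p" "k + 1 \<le> q"
  shows "(p - 1) * (ramsey_number k (p - 1) q - 1) < ramsey_number k p q"
proof (rule ccontr)
  define N where "N = ramsey_number k (p - 1) q - 1"
  define V where "V = {1..ramsey_number k p q}"
  assume "\<not> ?thesis"
  then have V: "V \<subseteq> {1..(p - 1) * N}" by (auto simp: V_def N_def)
  have W: "\<not> partn_lst {1..N} [p - 1, q] k"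
  proof (cases "ramsey_number k (p - 1) q")
    case 0
    then have N: "N = 0" by (simp add: N_def)
    have "\<not> monochromatic {1..N} ([p - 1, q] ! i) k (\<lambda>_. 0) i" if "i < length [p - 1, q]" for i
    proof -
      have "[p - 1, q] ! i \<noteq> 0" using that assms by (cases i) auto
      then show ?thesis by (auto simp: N monochromatic_def nsets_def)
    qed
    moreover have "(\<lambda>_. 0) \<in> nsets {1..N} k \<rightarrow> {..<length [p - 1, q]}" by simp
    ultimately show ?thesis unfolding partn_lst_def by blast
  next
    case (Suc n)
    then show ?thesis
      using not_less_Least[of N "\<lambda>N. partn_lst {1..N} [p - 1, q] k"]
      by (simp add: N_def ramsey_number_def)
  qed
  \<comment> \<open>The number \<open>x\<close> is the point \<open>(x - 1) mod N + 1\<close> of the group \<open>(x - 1) div N\<close>.\<close>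
  have "\<not> partn_lst V [p, q] k"
  proof (rule product_colouring[where g = "\<lambda>x. (x - 1) div N" and h = "\<lambda>x. (x - 1) mod N + 1"])
    show "inj_on (\<lambda>x. ((x - 1) div N, (x - 1) mod N + 1)) V"
    proof (rule inj_onI)
      fix x y assume "x \<in> V" "y \<in> V"
        and "((x - 1) div N, (x - 1) mod N + 1) = ((y - 1) div N, (y - 1) mod N + 1)"
      then have "x - 1 = y - 1" "1 \<le> x" "1 \<le> y"
        by (auto simp: V_def) (metis div_mult_mod_eq)
      then show "x = y" by simp
    qed
    show "finite V" by (simp add: V_def)
    have "(\<lambda>x. (x - 1) div N) ` V \<subseteq> {..<p - 1}"
    proof
      fix i assume "i \<in> (\<lambda>x. (x - 1) div N) ` V"
      then obtain x where "x \<in> V" "i = (x - 1) div N" by blast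
      moreover from this V have "x - 1 < (p - 1) * N" by fastforce
      ultimately show "i \<in> {..<p - 1}" by (simp add: less_mult_imp_div_less)
    qed
    then have "card ((\<lambda>x. (x - 1) div N) ` V) \<le> card {..<p - 1}" by (intro card_mono) auto
    then show "card ((\<lambda>x. (x - 1) div N) ` V) < p" using assms by simp
    show "(\<lambda>x. (x - 1) mod N + 1) ` V \<subseteq> {1..N}"
    proof
      fix i assume "i \<in> (\<lambda>x. (x - 1) mod N + 1) ` V"
      then obtain x where x: "x \<in> V" "i = (x - 1) mod N + 1" by blast
      then have "0 < N" using V by (cases N) auto
      then show "i \<in> {1..N}" using x by (simp add: Suc_le_eq)
    qed
  qed (use assms W in auto)
  then show False using partn_lst_ramsey_number by (simp add: V_def)
qed

section \<open>A colouring of partitions\<close>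

text \<open>The sequence red, blue, red, red, blue, red, blue, red, blue, \<dots>, starting with \<open>m = 1\<close>; true is blue.\<close>

definition alternating :: "nat \<Rightarrow> bool" where
  "alternating m \<longleftrightarrow> m = 2 \<or> odd m \<and> 5 \<le> m"

text \<open>The residues 0 and 3 modulo 4: a partition in general position is blue only if its number of odd parts is one of
them.  The same residues of \<open>k\<close> distinguish two cases in the exceptional families.\<close>

definition outer :: "nat \<Rightarrow> bool" where
  "outer n \<longleftrightarrow> n mod 4 \<in> {0, 3}"

text \<open>Hooks \<open>(k - m, 1, \<dots>, 1)\<close> with \<open>m\<close> ones after the first part, and partitions \<open>(k - m, m)\<close> with two parts.  In either family, lowering
partitions of \<open>k + 1\<close> and of \<open>k + 2\<close> forbids two consecutive blue and three consecutive red values of \<open>m\<close>,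
and the colours at both ends of the range of \<open>m\<close> are forced: red, blue at the beginning, and blue, red at the
end for hooks and for odd \<open>k\<close>.  If the parity of \<open>k\<close> does not suit a strictly alternating sequence, one red
element is doubled.  For \<open>k = 9\<close>, the four partitions with two parts have no such colouring.\<close>

definition hook_blue :: "nat \<Rightarrow> nat \<Rightarrow> bool" where
  "hook_blue k m \<longleftrightarrow> (if odd k then alternating m else even m)"

definition pair_blue :: "nat \<Rightarrow> nat \<Rightarrow> bool" where
  "pair_blue k m \<longleftrightarrow> (if k mod 4 = 1 then alternating m else even m)"

definition odd_parts :: "nat list \<Rightarrow> nat" where
  "odd_parts l = length (filter odd l)"

text \<open>The rule for partitions in general position.  Lowering a part changes the number \<open>n\<close> of odd parts by 1, in a
direction that depends on the parity of the part.  Colouring by \<open>n mod 4\<close> alone would leave a partition of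
\<open>k + 1\<close> without even parts no way to become red if \<open>n mod 4\<close> is 0 or 1.  Therefore a partition
with a single even part is blue only if, in addition, this part is larger than some odd part \<open>y \<ge> 3\<close>: lowering
the smallest part greater than 1 of a partition into odd parts then leads to a red one.

If the even part \<open>x\<close> is the only one, the part that follows it in the decreasing list, if any, is the largest
odd part below \<open>x\<close>.\<close>

definition regular_blue :: "nat list \<Rightarrow> bool" where
  "regular_blue l \<longleftrightarrow> outer (odd_parts l) \<and>
     (length l = Suc (odd_parts l) \<longrightarrow>
       (case dropWhile odd l of x # y # _ \<Rightarrow> 3 \<le> y | _ \<Rightarrow> False))"

text \<open>For \<open>k = 11\<close>, the colours of these eight partitions deviate from the general rules.\<close>

definition red11 :: "nat list set" where
  "red11 = {[3,2,2,2,1,1], [2,2,2,1,1,1,1,1], [3,3,2,2,1], [4,3,2,1,1]}"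

definition blue11 :: "nat list set" where
  "blue11 = {[3,3,3,1,1], [3,2,2,1,1,1,1], [3,2,2,2,2], [2,2,2,2,1,1,1]}"

text \<open>The blue partitions of \<open>k\<close>.  The rule for general position does not suffice among partitions with few parts or
with many ones, so that some of them are coloured individually.  Besides hooks and pairs, these are the
partitions into parts 2 and 1 with two, three, or four parts 2 (if \<open>k mod 4\<close> is 0 or 3), the partitions
\<open>(3, 3, 1, \<dots>, 1)\<close> and \<open>(4, 3, 1, \<dots>, 1)\<close> (if \<open>k mod 4\<close> is 1 or 2), and, for odd \<open>k\<close>, the partition
\<open>(k - 4, 2, 2)\<close> and some partitions \<open>(a, b, 2, 2)\<close>.\<close>

fun blue :: "nat \<Rightarrow> nat list \<Rightarrow> bool" where
  "blue k [] = False"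
| "blue k [a] = False"
| "blue k [a, b] = pair_blue k b"
| "blue k (a # b # c # l) =
    (if b = 1 then hook_blue k (length l + 2)
     else if a \<le> 4 \<and> k = 11 \<and> a # b # c # l \<in> red11 then False
     else if a \<le> 4 \<and> k = 11 \<and> a # b # c # l \<in> blue11 then True
     else if a = 2 \<and> outer k \<and> count_list (c # l) 2 \<le> 2 then count_list (c # l) 2 = 1
     else if c = 1 \<and> b = 3 \<and> a \<le> 4 \<and> \<not> outer k then a = 3
     else if c = 2 \<and> b = 2 \<and> l = [] \<and> odd k then True
     else if c = 2 \<and> l = [2] \<and> odd k \<and> odd (a + b) \<and> (a mod 4 = 0 \<or> b mod 4 = 0) then True
     else regular_blue (a # b # c # l))"

text \<open>Partitions with fewer than two parts are neither blue nor red.\<close>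

fun red :: "nat \<Rightarrow> nat list \<Rightarrow> bool" where
  "red k (a # b # l) = (\<not> blue k (a # b # l))"
| "red k _ = False"

definition has_red_child :: "nat \<Rightarrow> nat list \<Rightarrow> bool" where
  "has_red_child k l \<longleftrightarrow> list_ex (red k) (children l)"

definition has_blue_child :: "nat \<Rightarrow> nat list \<Rightarrow> bool" where
  "has_blue_child k l \<longleftrightarrow> list_ex (blue k) (children l)"

text \<open>This includes the exceptions \<open>(1, \<dots>, 1)\<close> and \<open>(k + 1, 1)\<close>, of which nothing is required.\<close>

definition has_blue_grandchild :: "nat \<Rightarrow> nat list \<Rightarrow> bool" where
  "has_blue_grandchild k l \<longleftrightarrow> hd l = 1 \<or> k < hd l \<or> list_ex (has_blue_child k) (children l)"

lemma length_blue: "blue k l \<Longrightarrow> 2 \<le> length l"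
  by (cases "(k, l)" rule: blue.cases) auto

lemma red_iff: "red k l \<longleftrightarrow> 2 \<le> length l \<and> \<not> blue k l"
  by (cases "(k, l)" rule: red.cases) auto

text \<open>The two requirements of \<^const>\<open>splitting_colour\<close> as a finite computation, over the partitions of \<open>k + 1\<close> and of
\<open>k + 2\<close>.\<close>

definition verified :: "nat \<Rightarrow> bool" where
  "verified k \<longleftrightarrow> all_partitions (has_red_child k) 1 k [] \<and>
     all_partitions (has_blue_grandchild k) 1 (Suc k) []"

lemma splitting_colour_blue:
  assumes "verified k"
  shows "splitting_colour k (blue k)"
proof -
  have checked: "all_partitions (has_red_child k) 1 k []"
    "all_partitions (has_blue_grandchild k) 1 (Suc k) []"
    using assms by (simp_all add: verified_def)
  show ?thesis
    unfolding splitting_colour_def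
  proof (intro allI impI conjI)
    fix l
    assume "is_partition l \<and> 2 \<le> length l" and sum: "sum_list l = k + 1"
    then have l: "is_partition l" "2 \<le> length l" "\<forall>x\<in>set l. 1 \<le> x"
      by (auto simp: is_partition_def Suc_le_eq intro: Nat.gr0I)
    have "has_red_child k (l @ [])"
      by (rule all_partitionsD[OF checked(1) _ l(1,2) _ l(3)]) (simp_all add: sum)
    then show "\<exists>c\<in>set (children l). 2 \<le> length c \<and> \<not> blue k c"
      by (simp add: has_red_child_def list_ex_iff red_iff)
  next
    fix l
    assume "is_partition l \<and> 2 \<le> length l"
      and sum: "sum_list l = k + 2 \<and> hd l \<noteq> 1 \<and> hd l \<le> k"
    then have l: "is_partition l" "2 \<le> length l" "\<forall>x\<in>set l. 1 \<le> x"
      by (auto simp: is_partition_def Suc_le_eq intro: Nat.gr0I)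
    have "has_blue_grandchild k (l @ [])"
      by (rule all_partitionsD[OF checked(2) _ l(1,2) _ l(3)]) (simp_all add: sum)
    then have "\<exists>c\<in>set (children l). \<exists>d\<in>set (children c). blue k d"
      using sum by (simp add: has_blue_grandchild_def has_blue_child_def list_ex_iff)
    then show "\<exists>c\<in>set (children l). \<exists>d\<in>set (children c). 2 \<le> length d \<and> blue k d"
      using length_blue by blast
  qed
qed

section \<open>Evaluation of the colouring\<close>

text \<open>The two conditions on the colour are checked for each single \<open>k\<close> by rewriting with the code equations.  The
following equations keep the number of rewriting steps small.\<close>

fun parity :: "nat \<Rightarrow> bool" where
  "parity 0 = False" | "parity (Suc 0) = True" | "parity (Suc (Suc n)) = parity n"

lemma even_parity [code_unfold]: "Suc (Suc 0) dvd n \<longleftrightarrow> \<not> parity n"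
  by (induction n rule: parity.induct) (auto simp flip: numeral_2_eq_2)

lemma mod_4_code: "Suc (Suc (Suc (Suc n))) mod 4 = n mod 4" by presburger

lemma outer_code [code]:
  "outer 0 \<longleftrightarrow> True" "outer (Suc 0) \<longleftrightarrow> False" "outer (Suc (Suc 0)) \<longleftrightarrow> False"
  "outer (Suc (Suc (Suc 0))) \<longleftrightarrow> True" "outer (Suc (Suc (Suc (Suc n)))) \<longleftrightarrow> outer n"
  using mod_4_code[of n] by (simp_all add: outer_def)

text \<open>Conditionals evaluate only the branch that is needed, whereas both sides of a conjunction or a disjunction would be
evaluated.\<close>

lemma conj_if [code_unfold]: "(P \<and> Q) = (if P then Q else False)" by simp

lemma disj_if [code_unfold]: "(P \<or> Q) = (if P then True else Q)" by simp

text \<open>Small literals appear as \<^const>\<open>nat_of_num\<close> terms when code equations are preprocessed; natural numbers are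
computed in terms of \<^const>\<open>Suc\<close>.\<close>

lemma nat_literals [code_unfold]:
  "nat_of_num (num.Bit0 num.One) = Suc (Suc 0)"
  "nat_of_num (num.Bit1 num.One) = Suc (Suc (Suc 0))"
  "nat_of_num (num.Bit0 (num.Bit0 num.One)) = Suc (Suc (Suc (Suc 0)))"
  by (simp_all add: nat_of_num_numeral)

text \<open>The rule for general position in a single pass over the parts, where \<open>n\<close> counts the odd parts seen so far.  The
function \<open>scan1\<close> takes over after the first even part; its flag \<open>w\<close> tells whether the partition may be blue if
there is no further even part.\<close>

fun scan1 :: "bool \<Rightarrow> nat \<Rightarrow> nat list \<Rightarrow> bool" where
  "scan1 w n [] \<longleftrightarrow> w \<and> outer n"
| "scan1 w n (x # xs) \<longleftrightarrow> (if odd x then scan1 w (Suc n) xs else scan1 True n xs)"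

fun scan :: "nat \<Rightarrow> nat list \<Rightarrow> bool" where
  "scan n [] \<longleftrightarrow> outer n"
| "scan n (x # xs) \<longleftrightarrow> (if odd x then scan (Suc n) xs else scan1 (case xs of y # _ \<Rightarrow> 3 \<le> y | _ \<Rightarrow> False) n xs)"

lemma scan1_eq: "scan1 w n l \<longleftrightarrow> outer (n + odd_parts l) \<and> (length l = odd_parts l \<longrightarrow> w)"
proof (induction w n l rule: scan1.induct)
  case (2 w n x xs)
  have "length (filter odd xs) \<noteq> Suc (length xs)"
    using length_filter_le[of odd xs] by linarith
  with 2 length_filter_le[of odd xs] show ?case by (auto simp: odd_parts_def)
qed (auto simp: odd_parts_def)

lemma scan_eq: "scan n l \<longleftrightarrow> outer (n + odd_parts l) \<and>
     (length l = Suc (odd_parts l) \<longrightarrow>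
       (case dropWhile odd l of x # y # _ \<Rightarrow> 3 \<le> y | _ \<Rightarrow> False))"
proof (induction n l rule: scan.induct)
  case (2 n x xs)
  then show ?case by (auto simp: odd_parts_def scan1_eq split: list.splits)
qed (auto simp: odd_parts_def)

lemma regular_blue_code [code]: "regular_blue l = scan 0 l"
  by (simp add: regular_blue_def scan_eq)

lemma verified_8: "verified 8" by code_simp
lemma verified_10: "verified 10" by code_simp
lemma verified_11: "verified 11" by code_simp
lemma verified_12: "verified 12" by code_simp
lemma verified_13: "verified 13" by code_simp
lemma verified_14: "verified 14" by code_simp
lemma verified_15: "verified 15" by code_simp
lemma verified_16: "verified 16" by code_simp
lemma verified_17: "verified 17" by code_simp
lemma verified_18: "verified 18" by code_simp
lemma verified_19: "verified 19" by code_simp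
lemma verified_20: "verified 20" by code_simp
lemma verified_21: "verified 21" by code_simp
lemma verified_22: "verified 22" by code_simp
lemma verified_23: "verified 23" by code_simp
lemma verified_24: "verified 24" by code_simp
lemma verified_25: "verified 25" by code_simp

section \<open>The recursive lower bound\<close>

lemma int_less_imp_bound:
  assumes "(p - 1) * (n - 1) < (m::nat)" "2 \<le> p"
  shows "(int p - 1) * (int n - 1) + 1 \<le> int m"
proof (cases "n = 0")
  case False
  then have "int ((p - 1) * (n - 1)) = (int p - 1) * (int n - 1)"
    using assms(2) by (simp add: of_nat_diff)
  with assms(1) show ?thesis by linarith
qed (use assms in auto)

theorem theorem3:
  shows "\<exists>c::real. c \<ge> 25 \<and>
    (\<forall>k p q :: nat. 8 \<le> k \<and> real k \<le> c \<and> k \<noteq> 9 \<and> p \<ge> k + 2 \<and> q \<ge> k + 1 \<longrightarrow>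
      int (ramsey_number k p q) \<ge>
        (int p - 1) * (int (ramsey_number k (p - 1) q) - 1) + 1)"
proof (intro exI[of _ 25] conjI allI impI)
  fix k p q :: nat
  assume *: "8 \<le> k \<and> real k \<le> 25 \<and> k \<noteq> 9 \<and> p \<ge> k + 2 \<and> q \<ge> k + 1"
  have "\<forall>i\<in>set (8 # [10..<26]). verified i"
    by (simp add: upt_rec verified_8 verified_10 verified_11 verified_12 verified_13 verified_14
        verified_15 verified_16 verified_17 verified_18 verified_19 verified_20 verified_21
        verified_22 verified_23 verified_24 verified_25)
  moreover have "k \<in> set (8 # [10..<26])" using * unfolding list.set set_upt by auto
  ultimately have "verified k" by blast
  with * have "(p - 1) * (ramsey_number k (p - 1) q - 1) < ramsey_number k p q"
    by (intro ramsey_number_product_bound[of k "blue k"] splitting_colour_blue) auto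
  with * show "(int p - 1) * (int (ramsey_number k (p - 1) q) - 1) + 1 \<le> int (ramsey_number k p q)"
    by (intro int_less_imp_bound) auto
qed simp

end
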